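(* Let $q$ be a prime power, $n=tt'$ with $t,t'\in\mathbb{N}$, and let $s,s'\in\mathbb{N}$ with $\gcd(s,t)=\gcd(s',t)=1$. Let $f(x)=\sum_{i=0}^{t'-1}a_ix^{q^{it+s}}$ and $g(x)=\sum_{i=0}^{t'-1}b_ix^{q^{it+s'}}$ in $\mathbb{F}_{q^n}[x]$ be R-$q^t$-partially scattered. Then $f(x)$ and $g(x)$ are weakly equivalent if and only if $s\equiv\pm s'\pmod t$.
   Context: An $\mathbb{F}_q$-linearized polynomial $f(x)\in\mathbb{F}_{q^n}[x]$ is R-$q^t$-partially scattered if for all $y,z\in\mathbb{F}_{q^n}^*$, $f(y)/y=f(z)/z$ and $y/z\in\mathbb{F}_{q^t}$ imply $y/z\in\mathbb{F}_q$. For such $f$ let $U_f=\{(x,f(x)):x\in\mathbb{F}_{q^n}\}\subseteq\mathbb{F}_{q^n}\times\mathbb{F}_{q^n}$. Regard $\mathbb{F}_{q^n}\times\mathbb{F}_{q^n}$ as a $2t'$-dimensional $\mathbb{F}_{q^t}$-vector space. Two $\mathbb{F}_q$-linearized polynomials $f,g$ are weakly equivalent if there exists $\varphi\in\Gamma\mathrm{L}(2t',q^t)$ (an invertible $\mathbb{F}_{q^t}$-semilinear map of this space) with $\varphi(U_f)=U_g$. *)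

theory Defs
  imports
    "HOL-Number_Theory.Number_Theory"
    "HOL-Computational_Algebra.Polynomial"
    "HOL-Library.Product_Plus"
    "HOL-Library.Cardinality"
begin

text \<open>
  The field with \<open>q ^ n\<close> elements is a type of sort \<open>{field, finite}\<close> with \<open>CARD('a) = q ^ n\<close>.
  For \<open>m = q ^ d\<close> with \<open>d\<close> dividing \<open>n\<close>, its unique subfield with \<open>m\<close> elements
  is the set of roots of \<open>X ^ m - X\<close>.
\<close>
definition subfield_of_order :: "nat \<Rightarrow> 'a::{field, finite} set" where
  "subfield_of_order m = {x. x ^ m = x}"

definition linearized :: "nat \<Rightarrow> 'a::{field, finite} poly \<Rightarrow> bool" where
  "linearized q f \<longleftrightarrow> (\<forall>k. coeff f k \<noteq> 0 \<longrightarrow> (\<exists>i. k = q ^ i))"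

definition R_partially_scattered :: "nat \<Rightarrow> nat \<Rightarrow> 'a::{field, finite} poly \<Rightarrow> bool" where
  "R_partially_scattered q t f \<longleftrightarrow>
     linearized q f \<and>
     (\<forall>y z. y \<noteq> 0 \<longrightarrow> z \<noteq> 0 \<longrightarrow> poly f y / y = poly f z / z \<longrightarrow>
        y / z \<in> subfield_of_order (q ^ t) \<longrightarrow> y / z \<in> subfield_of_order q)"

definition U :: "'a::{field, finite} poly \<Rightarrow> ('a \<times> 'a) set" where
  "U f = {(x, poly f x) |x. True}"

definition field_automorphism_on :: "'a::field set \<Rightarrow> ('a \<Rightarrow> 'a) \<Rightarrow> bool" where
  "field_automorphism_on K \<rho> \<longleftrightarrow>
     bij_betw \<rho> K K \<and> \<rho> 1 = 1 \<and>
     (\<forall>x\<in>K. \<forall>y\<in>K. \<rho> (x + y) = \<rho> x + \<rho> y \<and> \<rho> (x * y) = \<rho> x * \<rho> y)"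

text \<open>
  Invertible \<open>K\<close>-semilinear maps of \<open>'a \<times> 'a\<close>, regarded as a vector space over the subfield \<open>K\<close>
  with componentwise scalar multiplication. If \<open>K\<close> has \<open>q ^ t\<close> elements and
  \<open>CARD('a) = q ^ (t * t')\<close>, the dimension is \<open>2 * t'\<close> and this set is \<open>\<Gamma>L(2t', q\<^sup>t)\<close>.
  The companion automorphism \<open>\<rho>\<close> of \<open>K\<close> is not required to fix any larger subfield than the
  prime field.
\<close>
definition semilinear_group :: "'a::{field, finite} set \<Rightarrow> ('a \<times> 'a \<Rightarrow> 'a \<times> 'a) set" where
  "semilinear_group K = {\<phi>. bij \<phi> \<and> (\<forall>v w. \<phi> (v + w) = \<phi> v + \<phi> w) \<and>
     (\<exists>\<rho>. field_automorphism_on K \<rho> \<and>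
        (\<forall>c\<in>K. \<forall>x y. \<phi> (c * x, c * y) = (\<rho> c * fst (\<phi> (x, y)), \<rho> c * snd (\<phi> (x, y)))))}"

definition weakly_equivalent ::
  "nat \<Rightarrow> nat \<Rightarrow> 'a::{field, finite} poly \<Rightarrow> 'a poly \<Rightarrow> bool" where
  "weakly_equivalent q t f g \<longleftrightarrow>
     (\<exists>\<phi>\<in>semilinear_group (subfield_of_order (q ^ t)). \<phi> ` U f = U g)"

end

theory Submission
  imports Defs
begin

text \<open>
  Let \<open>K\<close> be the subfield of order \<open>q ^ t\<close> and \<open>\<sigma>\<close>, \<open>\<sigma>'\<close> the automorphisms
  \<open>c \<mapsto> c ^ (q ^ s)\<close>, \<open>c \<mapsto> c ^ (q ^ s')\<close> of \<open>K\<close>. Then \<open>f\<close> is \<open>\<sigma>\<close>-semilinear and \<open>g\<close> is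
  \<open>\<sigma>'\<close>-semilinear over \<open>K\<close>, and for \<open>t > 1\<close> partial scatteredness makes both of them bijective.
  If \<open>\<sigma> = \<sigma>'\<close>, the \<open>K\<close>-linear map \<open>(x, y) \<mapsto> (x, g (f\<inverse> y))\<close> sends \<open>U f\<close> to \<open>U g\<close>; if
  \<open>\<sigma>\<close> and \<open>\<sigma>'\<close> are inverse to each other, so does \<open>(x, y) \<mapsto> (y, g (f x))\<close>.
  Conversely, let \<open>\<phi> = (\<phi>\<^sub>1, \<phi>\<^sub>2)\<close> map \<open>U f\<close> to \<open>U g\<close>. Evaluating \<open>\<phi>\<close> at
  \<open>(c x, f (c x))\<close> gives, with \<open>d\<close> the image of \<open>c\<close> under the companion automorphism,
  \<open>d \<phi>\<^sub>2(x, 0) + \<sigma> d \<phi>\<^sub>2(0, f x) = \<sigma>' d g (\<phi>\<^sub>1(x, 0)) + \<sigma> (\<sigma>' d) g (\<phi>\<^sub>1(0, f x))\<close>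
  for every \<open>d\<close> in \<open>K\<close>. If \<open>\<sigma>'\<close> is neither \<open>\<sigma>\<close> nor its inverse, independence of automorphisms
  forces both coefficients on the left to vanish, so that \<open>\<phi>\<^sub>2 = 0\<close>.
\<close>

section \<open>Cardinality of subfields of a finite field\<close>

lemma finite_field_power_card_minus_1:
  fixes x :: "'a::{field, finite}"
  assumes "x \<noteq> 0"
  shows "x ^ (CARD('a) - 1) = 1"
proof -
  have "(\<Prod>y\<in>UNIV-{0}. x * y) = x ^ (CARD('a) - 1) * \<Prod>(UNIV-{0})"
    by (simp add: prod.distrib card_Diff_singleton)
  moreover have "(\<Prod>y\<in>UNIV-{0}. x * y) = \<Prod>(UNIV-{0})"
    by (rule prod.reindex_bij_witness[of _ "\<lambda>y. y / x" "\<lambda>y. x * y"]) (use assms in auto)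
  moreover have "\<Prod>(UNIV-{0::'a}) \<noteq> 0"
    by simp
  ultimately show ?thesis
    by (metis mult_cancel_right mult_1)
qed

text \<open>\<open>X ^ (m - 1) - 1\<close> divides \<open>X ^ (m ^ k - 1) - 1\<close>, of which
  every nonzero element is a root. The cofactor \<open>H\<close> has at most \<open>degree H\<close>
  roots, which leaves at least \<open>m - 1\<close> for \<open>P\<close>; zero is one more
  element.\<close>

lemma card_subfield_of_order_ge:
  assumes card: "CARD('a::{field, finite}) = m ^ k" and m: "m > 1"
  shows "m \<le> card (subfield_of_order m :: 'a set)"
proof -
  have "[m ^ k = 1 ^ k] (mod (m - 1))"
    by (rule cong_pow) (use m in \<open>simp add: cong_altdef_nat\<close>)
  then obtain r where r: "m ^ k - 1 = (m - 1) * r"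
    using m by (auto simp: cong_altdef_nat elim: dvdE)
  have k: "m ^ k > 1"
    using card_mono[of "UNIV::'a set" "{0, 1}"] card by simp
  define X P H where "X = monom (1::'a) (m - 1)" and "P = X - 1" and "H = (\<Sum>i<r. X ^ i)"
  have PH: "P * H = monom 1 (m ^ k - 1) - 1"
    unfolding P_def H_def power_diff_1_eq[symmetric] X_def r by (simp add: monom_power)
  have degree: "degree (monom (1::'a) e - 1) = e" if "e > 0" for e
    using that by (subst diff_conv_add_uminus, subst degree_add_eq_left) (auto simp: degree_monom_eq)
  have degPH: "degree (P * H) = m ^ k - 1" and degP: "degree P = m - 1"
    unfolding PH using k m by (auto simp: P_def X_def intro!: degree)
  have nz: "P \<noteq> 0" "H \<noteq> 0"
    using degPH k by auto
  have "UNIV - {0} \<subseteq> {x. poly P x = 0} \<union> {x. poly H x = 0}"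
  proof
    fix x :: 'a assume "x \<in> UNIV - {0}"
    then have "x ^ (m ^ k - 1) = 1"
      using finite_field_power_card_minus_1[of x] card by simp
    then have "poly (P * H) x = 0"
      unfolding PH by (simp add: poly_monom)
    then show "x \<in> {x. poly P x = 0} \<union> {x. poly H x = 0}"
      by simp
  qed
  then have "card (UNIV - {0::'a}) \<le> card ({x. poly P x = 0} \<union> {x. poly H x = 0})"
    by (intro card_mono) auto
  also have "\<dots> \<le> card {x. poly P x = 0} + card {x. poly H x = 0}"
    by (rule card_Un_le)
  also have "card {x. poly H x = 0} \<le> degree H"
    using nz by (intro card_poly_roots_bound)
  finally have "m ^ k - 1 \<le> card {x. poly P x = 0} + degree H"
    by (simp add: card card_Diff_singleton)
  moreover have "degree P + degree H = m ^ k - 1"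
    using degPH nz by (simp add: degree_mult_eq)
  ultimately have "m - 1 \<le> card {x. poly P x = 0}"
    using degP by linarith
  moreover have "poly P 0 \<noteq> 0"
    using m by (simp add: P_def X_def poly_monom power_0_left)
  ultimately have "m \<le> card (insert 0 {x. poly P x = 0})"
    by simp
  also have "\<dots> \<le> card (subfield_of_order m :: 'a set)"
  proof (rule card_mono)
    show "insert 0 {x. poly P x = 0} \<subseteq> subfield_of_order m"
    proof
      fix x assume "x \<in> insert 0 {x. poly P x = 0}"
      then have "x = 0 \<or> x ^ (m - 1) = 1"
        by (auto simp: P_def X_def poly_monom)
      moreover have "x ^ m = x * x ^ (m - 1)"
        using m by (simp flip: power_Suc)
      ultimately show "x \<in> subfield_of_order m"
        using m by (auto simp: subfield_of_order_def)
    qed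
  qed simp
  finally show ?thesis .
qed

lemma card_subfield_of_order_le:
  assumes m: "m > 1"
  shows "card (subfield_of_order m :: 'a::{field, finite} set) \<le> m"
proof -
  define P where "P = monom (1::'a) m - monom 1 1"
  have deg: "degree P = m"
    unfolding P_def using m
    by (subst diff_conv_add_uminus, subst degree_add_eq_left) (auto simp: degree_monom_eq)
  then have "card {x. poly P x = 0} \<le> m"
    using card_poly_roots_bound[of P] m by fastforce
  then show ?thesis
    by (simp add: P_def poly_monom subfield_of_order_def)
qed

section \<open>Frobenius powers and linearized polynomials\<close>

lemma subfield_of_order_power:
  "c \<in> subfield_of_order m \<Longrightarrow> c ^ k \<in> subfield_of_order m"
  unfolding subfield_of_order_def by (simp flip: power_mult) (simp add: mult.commute[of k] power_mult)

text \<open>On this subfield the \<open>q ^ t\<close>-th power is the identity, so Frobenius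
  exponents matter only modulo \<open>t\<close>.\<close>

lemma power_subfield_of_order_mod:
  assumes "c \<in> subfield_of_order (q ^ t)"
  shows "c ^ (q ^ e) = c ^ (q ^ (e mod t))"
proof -
  have "c ^ (q ^ (t * j)) = c" for j
    using assms by (induction j) (simp_all add: subfield_of_order_def power_add power_mult)
  moreover have "q ^ e = q ^ (t * (e div t)) * q ^ (e mod t)"
    by (simp flip: power_add)
  ultimately show ?thesis
    by (simp add: power_mult)
qed

text \<open>The characteristic is prime and divides \<open>CARD('a)\<close>, a power of
  \<open>p\<close>; it is therefore \<open>p\<close>.\<close>

lemma power_primepow_add:
  fixes x y :: "'a::{field, finite}"
  assumes "primepow q" and "CARD('a) = q ^ n"
  shows "(x + y) ^ (q ^ i) = x ^ (q ^ i) + y ^ (q ^ i)"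
proof -
  obtain p k where p: "prime p" "q = p ^ k"
    using assms(1) by (auto simp: primepow_def)
  have prime: "prime CHAR('a)"
    using finite_imp_CHAR_pos[where 'a='a] by (intro prime_CHAR_semidom) simp
  have "CHAR('a) dvd p ^ (k * n)"
    using CHAR_dvd_CARD[where 'a='a] assms p by (simp add: power_mult)
  then have "CHAR('a) = p"
    using prime p(1) by (metis prime_dvd_power primes_dvd_imp_eq)
  then show ?thesis
    using freshmans_dream'[OF prime, of "q ^ i" "k * i" x y] p by (simp add: power_mult)
qed

lemma poly_linearized:
  fixes f :: "'a::comm_semiring_1 poly"
  assumes "f = (\<Sum>i<t'. monom (a i) (q ^ (i * t + s)))"
  shows "poly f x = (\<Sum>i<t'. a i * x ^ (q ^ (i * t + s)))"
  using assms by (simp add: poly_sum poly_monom)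

lemma poly_linearized_add:
  fixes f :: "'a::{field, finite} poly"
  assumes "primepow q" and "CARD('a) = q ^ n"
    and "f = (\<Sum>i<t'. monom (a i) (q ^ (i * t + s)))"
  shows "poly f (x + y) = poly f x + poly f y"
  unfolding poly_linearized[OF assms(3)] power_primepow_add[OF assms(1,2)]
  by (simp add: distrib_left sum.distrib)

text \<open>All exponents \<open>i * t + s\<close> agree modulo \<open>t\<close>, so
  \<open>c\<close> leaves every term with the same factor.\<close>

lemma poly_linearized_semilinear:
  fixes f :: "'a::{field, finite} poly"
  assumes "f = (\<Sum>i<t'. monom (a i) (q ^ (i * t + s)))" and "c \<in> subfield_of_order (q ^ t)"
  shows "poly f (c * x) = c ^ (q ^ s) * poly f x"
proof -
  have "c ^ (q ^ (i * t + s)) = c ^ (q ^ s)" for i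
    using power_subfield_of_order_mod[OF assms(2)] by (metis mod_mult_self3)
  then show ?thesis
    by (simp add: poly_linearized[OF assms(1)] power_mult_distrib sum_distrib_left mult.left_commute)
qed

text \<open>
  If \<open>f z = 0\<close> with \<open>z \<noteq> 0\<close>, then \<open>f\<close> vanishes on the \<open>K\<close>-line of \<open>z\<close>, and scatteredness would
  give \<open>K \<subseteq> \<bbbF>\<^sub>q\<close>.
\<close>
lemma partially_scattered_bij:
  fixes f :: "'a::{field, finite} poly"
  assumes q: "primepow q" and card: "CARD('a) = q ^ (t * t')" and t: "t > 1"
    and f: "f = (\<Sum>i<t'. monom (a i) (q ^ (i * t + s)))"
    and scattered: "R_partially_scattered q t f"
  shows "bij (poly f)"
proof -
  have q1: "q > 1"
    using primepow_gt_Suc_0[OF q] by simp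
  have "card (subfield_of_order q :: 'a set) \<le> q"
    using q1 by (rule card_subfield_of_order_le)
  also have "q < q ^ t"
    using q1 t power_strict_increasing[of 1 t q] by simp
  also have "q ^ t \<le> card (subfield_of_order (q ^ t) :: 'a set)"
    using card one_less_power[OF q1, of t] t by (intro card_subfield_of_order_ge[of _ t']) (auto simp: power_mult)
  finally have "\<not> subfield_of_order (q ^ t) \<subseteq> (subfield_of_order q :: 'a set)"
    using card_mono[of "subfield_of_order q :: 'a set"] by (metis finite leD)
  then obtain c :: 'a where c: "c \<in> subfield_of_order (q ^ t)" "c \<notin> subfield_of_order q"
    by blast
  have c0: "c \<noteq> 0"
    using c(2) q1 by (auto simp: subfield_of_order_def)
  have kernel: "z = 0" if "poly f z = 0" for z
  proof (rule ccontr)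
    assume z: "z \<noteq> 0"
    have "poly f (c * z) = 0"
      using poly_linearized_semilinear[OF f c(1), of z] that by simp
    then have "c * z / z \<in> subfield_of_order q"
      using scattered that c(1) c0 z unfolding R_partially_scattered_def
      by (metis div_0 mult_eq_0_iff nonzero_mult_div_cancel_right)
    with z c(2) show False
      by simp
  qed
  have "inj (poly f)"
  proof (rule injI)
    fix x y assume "poly f x = poly f y"
    then have "poly f (x - y) = 0"
      using poly_linearized_add[OF q card f, of "x - y" y] by simp
    then show "x = y"
      using kernel by fastforce
  qed
  then show ?thesis
    by (simp add: bij_def finite_UNIV_inj_surj)
qed

section \<open>Independence of Frobenius powers\<close>

text \<open>With exponents reduced modulo \<open>t\<close>, both sides are polynomials in
  \<open>d\<close> of degree below \<open>q ^ t\<close> that agree at \<open>q ^ t\<close> or more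
  points, hence coincide. The conditions on \<open>i\<close>, \<open>j\<close>, \<open>k\<close>
  keep the monomials of \<open>\<alpha>\<close> and \<open>\<beta>\<close> apart from each other and
  from those on the right.\<close>

lemma frobenius_independent:
  fixes \<alpha> \<beta> \<gamma> \<delta> :: "'a::{field, finite}"
  assumes q: "q > 1" and card: "CARD('a) = q ^ (t * t')" and t: "t > 0"
    and eq: "\<And>d. d \<in> subfield_of_order (q ^ t) \<Longrightarrow>
      \<alpha> * d + \<beta> * d ^ (q ^ i) = \<gamma> * d ^ (q ^ j) + \<delta> * d ^ (q ^ k)"
    and i: "i mod t \<noteq> 0" and j: "j mod t \<noteq> 0" and k: "k mod t \<noteq> 0"
    and ij: "i mod t \<noteq> j mod t" and ik: "i mod t \<noteq> k mod t"
  shows "\<alpha> = 0" and "\<beta> = 0"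
proof -
  have inj: "q ^ u = q ^ v \<longleftrightarrow> u = v" for u v
    using q by (simp add: power_inject_exp)
  have deg: "degree (monom x (q ^ (u mod t)) + monom y (q ^ (v mod t))) < q ^ t" for x y :: 'a and u v
  proof (rule degree_add_less)
    show "degree (monom x (q ^ (u mod t))) < q ^ t"
      using degree_monom_le[of x "q ^ (u mod t)"] q t
      by (meson le_less_trans mod_less_divisor power_strict_increasing)
    show "degree (monom y (q ^ (v mod t))) < q ^ t"
      using degree_monom_le[of y "q ^ (v mod t)"] q t
      by (meson le_less_trans mod_less_divisor power_strict_increasing)
  qed
  have K: "q ^ t \<le> card (subfield_of_order (q ^ t) :: 'a set)"
    using card one_less_power[OF q t] by (intro card_subfield_of_order_ge[of _ t']) (auto simp: power_mult)
  have eq': "monom \<alpha> (q ^ (0 mod t)) + monom \<beta> (q ^ (i mod t)) =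
      monom \<gamma> (q ^ (j mod t)) + monom \<delta> (q ^ (k mod t))" (is "?P = ?R")
  proof (rule poly_eqI_degree)
    fix d :: 'a assume d: "d \<in> subfield_of_order (q ^ t)"
    show "poly ?P d = poly ?R d"
      using eq[OF d] by (simp add: poly_monom flip: power_subfield_of_order_mod[OF d])
  next
    show "degree ?P < card (subfield_of_order (q ^ t) :: 'a set)"
      using deg K by (rule less_le_trans)
    show "degree ?R < card (subfield_of_order (q ^ t) :: 'a set)"
      using deg K by (rule less_le_trans)
  qed
  show "\<alpha> = 0"
    using arg_cong[OF eq', of "\<lambda>p. coeff p (q ^ 0)"] i j k
    unfolding coeff_add coeff_monom inj by simp
  show "\<beta> = 0"
    using arg_cong[OF eq', of "\<lambda>p. coeff p (q ^ (i mod t))"] i ij ik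
    unfolding coeff_add coeff_monom inj by simp
qed

section \<open>Graphs and semilinear maps\<close>

lemma field_automorphism_on_power:
  assumes "field_automorphism_on (subfield_of_order m) \<rho>" and "c \<in> subfield_of_order m"
  shows "\<rho> (c ^ k) = \<rho> c ^ k"
  using assms subfield_of_order_power[OF assms(2)]
  by (induction k) (simp_all add: field_automorphism_on_def)

lemma U_poly_iff: "(x, y) \<in> U f \<longleftrightarrow> y = poly f x"
  by (auto simp: U_def)

lemma card_U: "card (U f) = CARD('a)" for f :: "'a::{field, finite} poly"
proof -
  have "U f = range (\<lambda>x. (x, poly f x))"
    by (auto simp: U_def)
  then show ?thesis
    by (simp add: card_image inj_on_def)
qed

text \<open>For a linear map the identity serves as companion automorphism. Both graphs have as many
  points as the field, so an injective map of one into the other is onto.\<close>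

lemma weakly_equivalentI:
  fixes f g :: "'a::{field, finite} poly"
  assumes inj: "inj \<phi>" and add: "\<And>v w. \<phi> (v + w) = \<phi> v + \<phi> w"
    and linear: "\<And>c x y. c \<in> subfield_of_order (q ^ t) \<Longrightarrow>
      \<phi> (c * x, c * y) = (c * fst (\<phi> (x, y)), c * snd (\<phi> (x, y)))"
    and U: "\<And>x. \<phi> (x, poly f x) \<in> U g"
  shows "weakly_equivalent q t f g"
proof -
  have "field_automorphism_on (subfield_of_order (q ^ t)) (\<lambda>x::'a. x)"
    by (simp add: field_automorphism_on_def bij_betw_def)
  moreover have "bij \<phi>"
    using inj by (simp add: bij_def finite_UNIV_inj_surj)
  ultimately have "\<phi> \<in> semilinear_group (subfield_of_order (q ^ t))"
    unfolding semilinear_group_def using add linear by blast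
  moreover have "\<phi> ` U f = U g"
  proof (rule card_subset_eq)
    show "\<phi> ` U f \<subseteq> U g"
      using U by (auto simp: U_def)
    show "card (\<phi> ` U f) = card (U g)"
      using inj by (simp add: card_U card_image inj_on_subset)
  qed simp
  ultimately show ?thesis
    unfolding weakly_equivalent_def by blast
qed

section \<open>Necessity of the congruence\<close>

lemma semilinear_weak_equivalence_exponents:
  fixes f g :: "'a::{field, finite} poly"
  assumes q: "q > 1" and card: "CARD('a) = q ^ (t * t')" and t: "t > 0"
    and f: "\<And>c x. c \<in> subfield_of_order (q ^ t) \<Longrightarrow> poly f (c * x) = c ^ (q ^ s) * poly f x"
    and g: "\<And>c x. c \<in> subfield_of_order (q ^ t) \<Longrightarrow> poly g (c * x) = c ^ (q ^ s') * poly g x"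
    and g_add: "\<And>x y. poly g (x + y) = poly g x + poly g y"
    and surj: "surj (poly f)"
    and s: "s mod t \<noteq> 0" "s' mod t \<noteq> 0"
    and equiv: "weakly_equivalent q t f g"
  shows "s mod t = s' mod t \<or> (s + s') mod t = 0"
proof (rule ccontr)
  assume contra: "\<not> ?thesis"
  define K where "K = (subfield_of_order (q ^ t) :: 'a set)"
  obtain \<phi> \<rho> where \<phi>: "bij \<phi>" "\<And>v w. \<phi> (v + w) = \<phi> v + \<phi> w" "\<phi> ` U f = U g"
    and \<rho>: "field_automorphism_on K \<rho>"
    and semi: "\<And>c x y. c \<in> K \<Longrightarrow> \<phi> (c * x, c * y) = (\<rho> c * fst (\<phi> (x, y)), \<rho> c * snd (\<phi> (x, y)))"
    using equiv unfolding weakly_equivalent_def semilinear_group_def K_def by blast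
  have key: "snd (\<phi> (x, 0)) * d + snd (\<phi> (0, poly f x)) * d ^ (q ^ s) =
      poly g (fst (\<phi> (x, 0))) * d ^ (q ^ s') + poly g (fst (\<phi> (0, poly f x))) * d ^ (q ^ (s + s'))"
    if d: "d \<in> K" for d x
  proof -
    obtain c where c: "c \<in> K" "d = \<rho> c"
      using \<rho> d unfolding field_automorphism_on_def bij_betw_def by blast
    have dk: "\<rho> (c ^ k) = d ^ k" for k
      using field_automorphism_on_power[of "q ^ t" \<rho> c] \<rho> c by (simp add: K_def)
    have cs: "c ^ (q ^ s) \<in> K" and ds: "d ^ (q ^ s) \<in> K"
      using c d by (auto simp: K_def intro: subfield_of_order_power)
    \<comment> \<open>The zeros are written as multiples of the different scalars \<open>c\<close>
      and \<open>c ^ (q ^ s)\<close>, so that semilinearity applies to each summand.\<close>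
    have "\<phi> (c * x, poly f (c * x)) = \<phi> (c * x, c * 0) + \<phi> (c ^ (q ^ s) * 0, c ^ (q ^ s) * poly f x)"
      using f[of c x] c by (simp add: K_def flip: \<phi>(2))
    also have "\<dots> = (d * fst (\<phi> (x, 0)), d * snd (\<phi> (x, 0)))
        + (d ^ (q ^ s) * fst (\<phi> (0, poly f x)), d ^ (q ^ s) * snd (\<phi> (0, poly f x)))"
      unfolding semi[OF c(1)] semi[OF cs] dk c(2) ..
    finally have *: "\<phi> (c * x, poly f (c * x)) =
        (d * fst (\<phi> (x, 0)) + d ^ (q ^ s) * fst (\<phi> (0, poly f x)),
         d * snd (\<phi> (x, 0)) + d ^ (q ^ s) * snd (\<phi> (0, poly f x)))"
      by simp
    have "\<phi> (c * x, poly f (c * x)) \<in> U g"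
      unfolding \<phi>(3)[symmetric] by (simp add: U_poly_iff)
    then have "d * snd (\<phi> (x, 0)) + d ^ (q ^ s) * snd (\<phi> (0, poly f x)) =
        poly g (d * fst (\<phi> (x, 0)) + d ^ (q ^ s) * fst (\<phi> (0, poly f x)))"
      unfolding * U_poly_iff .
    also have "\<dots> = d ^ (q ^ s') * poly g (fst (\<phi> (x, 0)))
        + (d ^ (q ^ s)) ^ (q ^ s') * poly g (fst (\<phi> (0, poly f x)))"
      using g d ds by (simp add: g_add K_def)
    finally show ?thesis
      by (simp add: power_add power_mult mult.commute)
  qed
  have j: "(s + s') mod t \<noteq> 0" "s mod t \<noteq> s' mod t"
    using contra by auto
  have "s mod t \<noteq> (s + s') mod t"
  proof
    assume "s mod t = (s + s') mod t"
    then have "[s + 0 = s + s'] (mod t)"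
      by (simp add: cong_def)
    with s(2) show False
      by (simp only: cong_add_lcancel_nat) (simp add: cong_def)
  qed
  note vanish = frobenius_independent[OF q card t key[unfolded K_def] s j(1) j(2) this]
  have 0: "snd (\<phi> (x, y)) = 0" for x y
  proof -
    \<comment> \<open>Surjectivity of \<open>f\<close> carries the vanishing at
      \<open>(0, poly f z)\<close> over to every \<open>(0, y)\<close>.\<close>
    obtain z where z: "y = poly f z"
      using surj by blast
    have "\<phi> (x, y) = \<phi> (x, 0) + \<phi> (0, y)"
      by (simp flip: \<phi>(2))
    then show ?thesis
      using vanish(1)[of x] vanish(2)[of z] z by simp
  qed
  have "(0, 1) \<in> range \<phi>"
    using \<phi>(1) by (simp add: bij_def)
  then obtain x y where "\<phi> (x, y) = (0, 1)"
    by (metis imageE surj_pair)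
  with 0[of x y] show False
    by simp
qed

section \<open>Explicit equivalences for the converse\<close>

lemma weakly_equivalent_equal_exponents:
  fixes f g :: "'a::{field, finite} poly"
  assumes t: "t > 0"
    and f: "\<And>c x. c \<in> subfield_of_order (q ^ t) \<Longrightarrow> poly f (c * x) = c ^ (q ^ s) * poly f x"
    and g: "\<And>c x. c \<in> subfield_of_order (q ^ t) \<Longrightarrow> poly g (c * x) = c ^ (q ^ s') * poly g x"
    and f_add: "\<And>x y. poly f (x + y) = poly f x + poly f y"
    and g_add: "\<And>x y. poly g (x + y) = poly g x + poly g y"
    and bij_f: "bij (poly f)" and bij_g: "bij (poly g)"
    and s: "s mod t = s' mod t"
  shows "weakly_equivalent q t f g"
proof -
  define F where "F = inv_into UNIV (poly f)"
  have fF: "poly f (F y) = y" and Ff: "F (poly f x) = x" for x y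
    using bij_f by (auto simp: F_def bij_def surj_f_inv_f)
  have F_add: "F (x + y) = F x + F y" for x y
    by (metis fF Ff f_add)
  have gF: "poly g (F (c * y)) = c * poly g (F y)" if c: "c \<in> subfield_of_order (q ^ t)" for c y
  proof -
    \<comment> \<open>This is the \<open>q ^ s\<close>-th root of \<open>c\<close> in the subfield:
      the exponents \<open>(t - 1) * s\<close> and \<open>s\<close> add up to a multiple of
      \<open>t\<close>.\<close>
    define d where "d = c ^ (q ^ ((t - 1) * s))"
    have d: "d \<in> subfield_of_order (q ^ t)"
      unfolding d_def using c by (rule subfield_of_order_power)
    have "(t - 1) * s + s = t * s"
      using t by (cases t) auto
    then have "d ^ (q ^ s) = c ^ (q ^ (t * s))"
      unfolding d_def by (metis power_add power_mult)
    also have "\<dots> = c"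
      using power_subfield_of_order_mod[OF c, of "t * s"] by simp
    finally have ds: "d ^ (q ^ s) = c" .
    then have "poly f (d * F y) = c * y"
      using f[OF d] fF by simp
    then have "F (c * y) = d * F y"
      by (metis Ff)
    moreover have "d ^ (q ^ s') = c"
      using ds s power_subfield_of_order_mod[OF d] by metis
    ultimately show ?thesis
      using g[OF d] by simp
  qed
  have "inj F"
    by (metis fF injI)
  then have inj_gF: "poly g (F x) = poly g (F y) \<longleftrightarrow> x = y" for x y
    using bij_g by (simp add: bij_def inj_eq)
  show ?thesis
    by (rule weakly_equivalentI[where \<phi> = "\<lambda>v. (fst v, poly g (F (snd v)))"])
      (simp_all add: inj_def prod_eq_iff F_add g_add gF Ff inj_gF U_poly_iff)
qed

lemma weakly_equivalent_opposite_exponents: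
  fixes f g :: "'a::{field, finite} poly"
  assumes f: "\<And>c x. c \<in> subfield_of_order (q ^ t) \<Longrightarrow> poly f (c * x) = c ^ (q ^ s) * poly f x"
    and g: "\<And>c x. c \<in> subfield_of_order (q ^ t) \<Longrightarrow> poly g (c * x) = c ^ (q ^ s') * poly g x"
    and f_add: "\<And>x y. poly f (x + y) = poly f x + poly f y"
    and g_add: "\<And>x y. poly g (x + y) = poly g x + poly g y"
    and bij_f: "bij (poly f)" and bij_g: "bij (poly g)"
    and s: "(s + s') mod t = 0"
  shows "weakly_equivalent q t f g"
proof -
  have gf: "poly g (poly f (c * x)) = c * poly g (poly f x)"
    if c: "c \<in> subfield_of_order (q ^ t)" for c x
  proof -
    have "poly g (poly f (c * x)) = (c ^ (q ^ s)) ^ (q ^ s') * poly g (poly f x)"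
      using f[OF c] g[OF subfield_of_order_power[OF c]] by simp
    also have "(c ^ (q ^ s)) ^ (q ^ s') = c"
      using power_subfield_of_order_mod[OF c, of "s + s'"] s by (simp add: power_add power_mult)
    finally show ?thesis .
  qed
  have inj_gf: "poly g (poly f x) = poly g (poly f y) \<longleftrightarrow> x = y" for x y
    using bij_f bij_g by (simp add: bij_def inj_eq)
  show ?thesis
    by (rule weakly_equivalentI[where \<phi> = "\<lambda>v. (snd v, poly g (poly f (fst v)))"])
      (simp_all add: inj_def prod_eq_iff f_add g_add gf inj_gf U_poly_iff)
qed

text \<open>
  For \<open>t = 1\<close> the polynomials need not be bijective, but they are linear over \<open>K = \<bbbF>\<^sub>q\<close>, so the
  shear taking the graph of \<open>f\<close> to that of \<open>g\<close> is available.
\<close>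
lemma weakly_equivalent_linear:
  fixes f g :: "'a::{field, finite} poly"
  assumes f: "\<And>c x. c \<in> subfield_of_order (q ^ t) \<Longrightarrow> poly f (c * x) = c * poly f x"
    and g: "\<And>c x. c \<in> subfield_of_order (q ^ t) \<Longrightarrow> poly g (c * x) = c * poly g x"
    and f_add: "\<And>x y. poly f (x + y) = poly f x + poly f y"
    and g_add: "\<And>x y. poly g (x + y) = poly g x + poly g y"
  shows "weakly_equivalent q t f g"
proof -
  show ?thesis
    by (rule weakly_equivalentI[where \<phi> = "\<lambda>v. (fst v, snd v - poly f (fst v) + poly g (fst v))"])
      (simp_all add: inj_def prod_eq_iff f g f_add g_add U_poly_iff algebra_simps)
qed

theorem theorem8p2:
  fixes q n t t' s s' :: nat
    and a b :: "nat \<Rightarrow> 'a::{field, finite}"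
    and f g :: "'a poly"
  assumes "primepow q"
    and "t > 0" and "t' > 0" and "n = t * t'"
    and "CARD('a) = q ^ n"
    and "coprime s t" and "coprime s' t"
    and "f = (\<Sum>i<t'. monom (a i) (q ^ (i * t + s)))"
    and "g = (\<Sum>i<t'. monom (b i) (q ^ (i * t + s')))"
    and "R_partially_scattered q t f"
    and "R_partially_scattered q t g"
  shows "weakly_equivalent q t f g \<longleftrightarrow>
    [int s = int s'] (mod int t) \<or> [int s = - int s'] (mod int t)"
proof -
  have q: "q > 1"
    using primepow_gt_Suc_0[OF assms(1)] by simp
  have card: "CARD('a) = q ^ (t * t')"
    using assms(4,5) by simp
  note f = poly_linearized_semilinear[OF assms(8)] and g = poly_linearized_semilinear[OF assms(9)]
  note f_add = poly_linearized_add[OF assms(1,5,8)] and g_add = poly_linearized_add[OF assms(1,5,9)]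
  have "int s mod int t = int s' mod int t \<longleftrightarrow> s mod t = s' mod t"
    by (metis of_nat_eq_iff zmod_int)
  then have same: "[int s = int s'] (mod int t) \<longleftrightarrow> s mod t = s' mod t"
    by (simp add: cong_def)
  have "[int s = - int s'] (mod int t) \<longleftrightarrow> int t dvd int (s + s')"
    by (simp add: cong_iff_dvd_diff)
  then have opposite: "[int s = - int s'] (mod int t) \<longleftrightarrow> (s + s') mod t = 0"
    by (metis dvd_eq_mod_eq_0 int_dvd_int_iff)
  show ?thesis
  proof (cases "t = 1")
    \<comment> \<open>Modulo 1 the congruences always hold, so an equivalence has to be exhibited
      for every pair.\<close>
    case True
    have "c ^ (q ^ e) = c" if "c \<in> subfield_of_order (q ^ t)" for c :: 'a and e
      using power_subfield_of_order_mod[OF that, of e] True by simp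
    then have "weakly_equivalent q t f g"
      using f g f_add g_add by (intro weakly_equivalent_linear) auto
    then show ?thesis
      using True by (simp add: same)
  next
    case False
    with \<open>t > 0\<close> have t: "t > 1"
      by simp
    \<comment> \<open>For \<open>t > 1\<close> coprimality makes both Frobenius powers nontrivial on
      the subfield, as the independence argument requires.\<close>
    have s: "s mod t \<noteq> 0" "s' mod t \<noteq> 0"
      using assms(6,7) t by (auto simp: mod_eq_0_iff_dvd dest: coprime_absorb_right)
    have bij: "bij (poly f)" "bij (poly g)"
      using partially_scattered_bij[OF assms(1) card t] assms(8-11) by blast+
    show ?thesis
      unfolding same opposite
    proof
      assume equiv: "weakly_equivalent q t f g"
      show "s mod t = s' mod t \<or> (s + s') mod t = 0"
        by (rule semilinear_weak_equivalence_exponents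
            [OF q card \<open>t > 0\<close> f g g_add bij_is_surj[OF bij(1)] s equiv])
    next
      assume "s mod t = s' mod t \<or> (s + s') mod t = 0"
      then show "weakly_equivalent q t f g"
      proof
        show ?thesis if "s mod t = s' mod t"
          by (rule weakly_equivalent_equal_exponents[OF \<open>t > 0\<close> f g f_add g_add bij that])
        show ?thesis if "(s + s') mod t = 0"
          by (rule weakly_equivalent_opposite_exponents[OF f g f_add g_add bij that])
      qed
    qed
  qed
qed

end
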